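(* Let $(X,d_X)$ and $(Y,d_Y)$ be metric spaces and let $f:X\to Y$ be a discrete $c$-co-Lipschitz mapping for some $c>0$. Then $f$ is strongly $c$-co-Lipschitz at each $x\in X$.
   Context: $B^Z_s(z)$ denotes the open ball of radius $s>0$ centred at $z$ in the metric space $Z$; $\mathrm{Int}$ denotes topological interior. A subset $S\subseteq X$ is a discrete set if for each $x\in S$ there is a neighbourhood $U$ of $x$ with $U\cap S=\{x\}$; $f:X\to Y$ is a discrete mapping if $f^{-1}(y)$ is a discrete set for each $y\in Y$. $f$ is $c$-co-Lipschitz if $B^Y_{cr}(f(x))\subseteq f(B^X_r(x))$ for every $x\in X$ and every $r>0$. $f$ is strongly $c$-co-Lipschitz at $x_0$ if there is $\rho>0$ such that (i) $f(x_0)\in\mathrm{Int}\left(f(B^X_\rho(x_0))\right)$ and (ii) $d_Y(f(x),f(x_0))\ge c\,d_X(x,x_0)$ for all $x\in B^X_\rho(x_0)$. *)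

theory Defs
  imports "HOL-Analysis.Analysis"
begin

definition discrete_mapping :: "('a::topological_space \<Rightarrow> 'b) \<Rightarrow> bool" where
  "discrete_mapping f \<longleftrightarrow> (\<forall>y. discrete (f -` {y}))"

definition co_lipschitz :: "real \<Rightarrow> ('a::metric_space \<Rightarrow> 'b::metric_space) \<Rightarrow> bool" where
  "co_lipschitz c f \<longleftrightarrow> (\<forall>x. \<forall>r>0. ball (f x) (c * r) \<subseteq> f ` ball x r)"

definition strongly_co_lipschitz_at ::
    "real \<Rightarrow> ('a::metric_space \<Rightarrow> 'b::metric_space) \<Rightarrow> 'a \<Rightarrow> bool" where
  "strongly_co_lipschitz_at c f x\<^sub>0 \<longleftrightarrow>
    (\<exists>\<rho>>0. f x\<^sub>0 \<in> interior (f ` ball x\<^sub>0 \<rho>) \<and>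
       (\<forall>x\<in>ball x\<^sub>0 \<rho>. dist (f x) (f x\<^sub>0) \<ge> c * dist x x\<^sub>0))"

end

theory Submission
  imports Defs
begin

text \<open>
  The inclusion of balls in the co-Lipschitz condition is a lifting property: any value closer to
  \<open>f x\<close> than \<open>c * r\<close> is attained closer to \<open>x\<close> than \<open>r\<close>. Suppose that some \<open>x\<close> near \<open>a\<close> satisfies
  \<open>dist (f x) (f a) < c * dist x a\<close>. Lifting the value \<open>f a\<close> from \<open>x\<close> gives a point of the
  fibre of \<open>f a\<close> that is strictly closer to \<open>x\<close> than \<open>a\<close> is. This point differs from \<open>a\<close>, yet
  it lies within \<open>2 * dist x a\<close> of \<open>a\<close>, which is impossible once \<open>x\<close> is so close to \<open>a\<close> that the
  ball of twice the radius meets the discrete fibre only in \<open>a\<close>. The interior condition holds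
  at every radius, because the image of a ball contains a ball about the image of its centre.
\<close>

lemma discrete_mapping_isolates_in_fibre:
  fixes f :: "'a::metric_space \<Rightarrow> 'b"
  assumes "discrete_mapping f"
  obtains e where "e > 0" "\<And>z. f z = f a \<Longrightarrow> dist a z < e \<Longrightarrow> z = a"
proof -
  have "a isolated_in (f -` {f a})"
    using assms by (auto simp: discrete_mapping_def intro: discreteD)
  then obtain e where "e > 0" "\<forall>z\<in>f -` {f a}. dist a z < e \<longrightarrow> z = a"
    by (auto simp: isolated_in_dist_Ex_iff)
  then show thesis
    by (intro that[of e]) auto
qed

lemma co_lipschitz_lift:
  assumes "co_lipschitz c f" "r > 0" "dist (f x) y < c * r"
  obtains z where "f z = y" "dist x z < r"
  using assms by (force simp: co_lipschitz_def subset_iff image_iff)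

lemma co_lipschitz_image_ball_interior:
  assumes "co_lipschitz c f" "c > 0" "r > 0"
  shows "f x \<in> interior (f ` ball x r)"
proof (rule interiorI)
  show "open (ball (f x) (c * r))" "f x \<in> ball (f x) (c * r)"
    using assms by auto
  show "ball (f x) (c * r) \<subseteq> f ` ball x r"
    using assms by (simp add: co_lipschitz_def)
qed

theorem lemma2p23:
  fixes f :: "'a::metric_space \<Rightarrow> 'b::metric_space" and c :: real
  assumes "c > 0"
    and "discrete_mapping f"
    and "co_lipschitz c f"
  shows "\<forall>x. strongly_co_lipschitz_at c f x"
proof
  fix a
  obtain e where e: "e > 0" "\<And>z. f z = f a \<Longrightarrow> dist a z < e \<Longrightarrow> z = a"
    using discrete_mapping_isolates_in_fibre[OF assms(2)] by metis
  have "c * dist x a \<le> dist (f x) (f a)" if x: "x \<in> ball a (e / 2)" for x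
  proof (rule ccontr)
    assume "\<not> ?thesis"
    then have less: "dist (f x) (f a) < c * dist x a"
      by simp
    then have "dist x a > 0"
      by auto
    then obtain z where z: "f z = f a" "dist x z < dist x a"
      using co_lipschitz_lift[OF assms(3) _ less] by metis
    have "dist a z < e"
      using x z(2) dist_triangle[of a z x] by (simp add: dist_commute)
    then have "z = a"
      using e(2) z(1) by blast
    then show False
      using z(2) by simp
  qed
  then show "strongly_co_lipschitz_at c f a"
    unfolding strongly_co_lipschitz_at_def
    using co_lipschitz_image_ball_interior[OF assms(3,1)] \<open>e > 0\<close>
    by (intro exI[of _ "e / 2"]) auto
qed

end
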